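(* Let $\mathbb{F}_q$ be a finite field with $q=p^k$ elements, where $p\equiv 1\pmod 3$ is prime, and let $a_1,a_2,a_3\in\mathbb{F}_q^{\ast}$. Let $N(a_1,a_2,a_3)$ denote the number of $(x_1,x_2)\in\mathbb{F}_q^2$ with $a_1x_1^3+a_2x_2^3=a_3$. Let $c,d$ be the integers uniquely determined by $$4q=c^2+27d^2,\quad c\equiv 1\pmod 3,\quad (c,p)=1,\quad 9d\equiv c\left(2(a_1a_2a_3)^{\frac{q-1}{3}}+1\right)\pmod p,$$ with $(a_1a_2a_3)^{(q-1)/3}\in\mathbb{F}_p$ identified with an integer residue mod $p$. (1) If $a_1a_2a_3$ is cubic, then $N(a_1,a_2,a_3)=q-2+c$ if $a_1a_2^{-1}$ is cubic, and $N(a_1,a_2,a_3)=q+1+c$ otherwise. (2) If $a_1a_2a_3$ is non-cubic, then $N(a_1,a_2,a_3)=q-2+\frac{1}{2}(9d-c)$ if $a_1a_2^{-1}$ is cubic, and $N(a_1,a_2,a_3)=q+1+\frac{1}{2}(9d-c)$ otherwise.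
   Context: An element $z\in\mathbb{F}_q^{\ast}$ is called cubic if $z=y^3$ for some $y\in\mathbb{F}_q^{\ast}$, and non-cubic otherwise.
   Formalization: In part (1) the congruence 9d ≡ c(2(a1a2a3)^((q-1)/3)+1) (mod p) is dropped, since for cubic a1a2a3 it contradicts (c,p)=1 (e.g. q=7); there c alone is shown unique from the first three conditions. Part (2) is as stated. *)

theory Defs
  imports Complex_Main "HOL-Library.Cardinality" "HOL-Number_Theory.Number_Theory"
begin

definition cubic :: "'a::field \<Rightarrow> bool" where
  "cubic z \<longleftrightarrow> (\<exists>y. y \<noteq> 0 \<and> z = y ^ 3)"

definition N :: "'a::{field,finite} \<Rightarrow> 'a \<Rightarrow> 'a \<Rightarrow> nat" where
  "N a1 a2 a3 = card {(x1, x2). a1 * x1 ^ 3 + a2 * x2 ^ 3 = a3}"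

definition normalized_rep :: "nat \<Rightarrow> nat \<Rightarrow> int \<Rightarrow> int \<Rightarrow> bool" where
  "normalized_rep p q c d \<longleftrightarrow>
     4 * int q = c\<^sup>2 + 27 * d\<^sup>2 \<and> [c = 1] (mod 3) \<and> coprime c (int p)"

text \<open>
  The integer \<open>w\<close> is a residue modulo \<open>p\<close> representing \<open>a ^ ((q - 1) / 3)\<close>, an element of the
  prime field. The condition fixes the sign of \<open>d\<close> when \<open>a\<close> is non-cubic. When \<open>a\<close> is cubic it
  reads \<open>9 d \<equiv> 3 c\<close>, which is incompatible with \<open>normalized_rep p q c d\<close>, since together they
  give \<open>4 c\<^sup>2 \<equiv> 0\<close> modulo \<open>p\<close>.
\<close>
definition sign_condition :: "nat \<Rightarrow> 'a::{field,finite} \<Rightarrow> int \<Rightarrow> int \<Rightarrow> bool" where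
  "sign_condition p a c d \<longleftrightarrow>
     (\<exists>w::int. (of_int w :: 'a) = a ^ ((CARD('a) - 1) div 3) \<and>
        [9 * d = c * (2 * w + 1)] (mod int p))"

end

theory Submission
  imports Defs "HOL-Computational_Algebra.Polynomial"
begin

text \<open>
  Write \<open>q = 3 m + 1\<close> and let \<open>\<chi>\<close> be a cubic character of the field, with Jacobi sum
  \<open>J = \<Sum>\<^sub>t \<chi>(t) \<chi>(1 - t)\<close>. Counting cube roots by \<open>1 + \<chi> + \<chi>\<^sup>2\<close> expresses \<open>N(a\<^sub>1, a\<^sub>2, a\<^sub>3)\<close> through
  \<open>J\<close>, \<open>\<chi>(a\<^sub>1 a\<^sub>2 a\<^sub>3)\<close> and \<open>\<chi>(a\<^sub>1 / a\<^sub>2)\<close>. Moreover \<open>J \<equiv> - q\<close> modulo \<open>3 \<int>[\<omega>]\<close>, say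
  \<open>J = 3 (u + v \<omega>) - q\<close>, so \<open>\<bar>J\<bar>\<^sup>2 = q\<close> becomes \<open>4 q = c\<^sup>2 + 27 d\<^sup>2\<close> with \<open>c = J + cnj J\<close> and
  \<open>d = v\<close>. Normalising \<open>\<chi>\<close> so that it reduces to \<open>x \<mapsto> x\<^sup>m\<close> at a prime above \<open>p\<close>, power sums over the
  field show that \<open>J\<close> reduces to \<open>0\<close> and its conjugate to \<open>\<plusminus>(2m choose m) \<noteq> 0\<close>. This yields both
  the coprimality of \<open>c\<close> and \<open>p\<close> and the congruence that fixes the sign of \<open>d\<close>. A representation of
  \<open>4 q\<close> prime to \<open>p\<close> is unique up to signs.
\<close>

subsection \<open>Central binomial coefficients and representations of \<open>4 q\<close>\<close>

text \<open>Legendre's recursion: the multiples of \<open>p\<close> up to \<open>p * n + s\<close>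
  are \<open>p * 1, ..., p * n\<close>, and together they contribute \<open>n\<close> factors
  \<open>p\<close> besides those of \<open>fact n\<close>.\<close>

lemma multiplicity_fact_mult_add:
  fixes p n s :: nat
  assumes "prime p" "s < p"
  shows "multiplicity p (fact (p * n + s) :: nat) = n + multiplicity p (fact n :: nat)"
  using assms(2)
proof (induction n arbitrary: s)
  case 0
  then show ?case
    using assms(1) by (simp add: not_dvd_imp_multiplicity_0 prime_dvd_fact_iff)
next
  case (Suc n)
  have pr: "prime_elem p" using assms(1) by auto
  have p0: "p > 0" using assms(1) prime_gt_0_nat by blast
  show ?case using Suc.prems
  proof (induction s)
    case 0
    have "p * Suc n = Suc (p * n + (p - 1))" using p0 by simp
    then have "(fact (p * Suc n + 0) :: nat) = p * Suc n * fact (p * n + (p - 1))"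
      by (metis fact_Suc add_0_right of_nat_id)
    then have "multiplicity p (fact (p * Suc n + 0) :: nat)
        = multiplicity p p + multiplicity p (Suc n) + multiplicity p (fact (p * n + (p - 1)) :: nat)"
      using prime_elem_multiplicity_mult_distrib[OF pr, of p "Suc n"] p0
        prime_elem_multiplicity_mult_distrib[OF pr, of "p * Suc n" "fact (p * n + (p - 1))"]
      by (simp del: mult_Suc mult_Suc_right)
    also have "multiplicity p (fact (p * n + (p - 1)) :: nat) = n + multiplicity p (fact n :: nat)"
      using p0 by (intro Suc.IH) auto
    also have "multiplicity p p = 1"
      using pr by (simp add: multiplicity_self)
    finally show ?case
      using pr by (simp add: prime_elem_multiplicity_mult_distrib del: mult_Suc)
  next
    case (Suc s)
    have nd: "\<not> p dvd Suc (p * Suc n + s)"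
    proof
      assume "p dvd Suc (p * Suc n + s)"
      then have "p dvd p * Suc n + Suc s" by simp
      then have "p dvd Suc s" by (metis dvd_add_right_iff dvd_triv_left)
      with Suc.prems show False by (auto dest: dvd_imp_le)
    qed
    have "(fact (p * Suc n + Suc s) :: nat) = Suc (p * Suc n + s) * fact (p * Suc n + s)"
      by (simp add: fact_Suc del: mult_Suc_right mult_Suc)
    then have "multiplicity p (fact (p * Suc n + Suc s) :: nat)
        = multiplicity p (Suc (p * Suc n + s)) + multiplicity p (fact (p * Suc n + s) :: nat)"
      using prime_elem_multiplicity_mult_distrib[OF pr, of "Suc (p * Suc n + s)" "fact (p * Suc n + s)"]
      by (simp del: mult_Suc mult_Suc_right)
    with nd Suc show ?case
      by (simp add: not_dvd_imp_multiplicity_0 del: mult_Suc_right)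
  qed
qed

text \<open>In base \<open>p\<close> all digits of \<open>m\<close> equal \<open>(p - 1) / 3\<close>, so \<open>m + m\<close> has no carries.\<close>

lemma prime_not_dvd_central_binomial:
  fixes p m k :: nat
  assumes "prime p" "[p = 1] (mod 3)" "3 * m + 1 = p ^ k"
  shows "\<not> p dvd (2 * m) choose m"
proof -
  obtain r where r: "p = 3 * r + 1"
  proof -
    have "p mod 3 = 1" using assms(2) by (simp add: cong_def)
    then have "p = 3 * (p div 3) + 1" using mult_div_mod_eq[of 3 p] by linarith
    then show ?thesis using that by blast
  qed
  have pr: "prime_elem p" using assms(1) by auto
  have *: "multiplicity p (fact (2 * m) :: nat) = 2 * multiplicity p (fact m :: nat)"
    using assms(3)
  proof (induction k arbitrary: m)
    case 0
    then show ?case by simp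
  next
    case (Suc k)
    \<comment> \<open>\<open>n\<close> is \<open>m\<close> with its last base-\<open>p\<close> digit
      \<open>r\<close> removed.\<close>
    define n where "n = (p ^ k - 1) div 3"
    have "[p ^ k = 1] (mod 3)"
      using cong_pow[OF assms(2), of k] by simp
    then have "p ^ k mod 3 = 1" by (simp add: cong_def)
    then have n: "3 * n + 1 = p ^ k" using mult_div_mod_eq[of 3 "p ^ k"] unfolding n_def by presburger
    have "3 * m + 1 = p * (3 * n + 1)" using Suc.prems n by simp
    also have "\<dots> = 3 * (p * n + r) + 1" using r by (simp add: algebra_simps)
    finally have m: "m = p * n + r" by simp
    \<comment> \<open>Since \<open>2 * r < p = 3 * r + 1\<close>, doubling causes no carry, and the
      recursion applies to \<open>2 * m\<close> with last digit \<open>2 * r\<close>.\<close>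
    have "multiplicity p (fact (p * (2 * n) + 2 * r) :: nat) = 2 * n + multiplicity p (fact (2 * n) :: nat)"
      using r by (intro multiplicity_fact_mult_add assms) auto
    moreover have "multiplicity p (fact (p * n + r) :: nat) = n + multiplicity p (fact n :: nat)"
      using r by (intro multiplicity_fact_mult_add assms) auto
    moreover have "2 * m = p * (2 * n) + 2 * r" using m by simp
    ultimately show ?case using Suc.IH[OF n] m by (metis add_mult_distrib2)
  qed
  have f: "(fact (2 * m) :: nat) = fact m * fact m * ((2 * m) choose m)"
    using binomial_fact_lemma[of m "2 * m"] by (simp add: mult_2)
  have "multiplicity p (fact (2 * m) :: nat)
      = multiplicity p (fact m :: nat) + multiplicity p (fact m :: nat) + multiplicity p ((2 * m) choose m)"
    unfolding f using pr by (simp add: prime_elem_multiplicity_mult_distrib)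
  with * have "multiplicity p ((2 * m) choose m) = 0" by simp
  then show ?thesis
    using pr multiplicity_eq_zero_iff[of "(2 * m) choose m" p] prime_gt_1_nat[OF assms(1)] by simp
qed

text \<open>\<open>q\<close> divides the product of \<open>c * d' - c' * d\<close> and
  \<open>c * d' + c' * d\<close>, while \<open>p\<close> cannot divide both factors. So
  \<open>q\<close> divides one of them, and size forces that one to vanish. This gives equality up
  to signs, and the residue modulo 3 fixes the sign of \<open>c\<close>.\<close>

lemma normalized_rep_unique:
  assumes "prime p" "p > 3" "q = p ^ k" "k > 0"
    and "normalized_rep p q c d" "normalized_rep p q c' d'"
  shows "c' = c \<and> (d' = d \<or> d' = - d)"
proof -
  have eq: "4 * int q = c\<^sup>2 + 27 * d\<^sup>2" "4 * int q = c'\<^sup>2 + 27 * d'\<^sup>2"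
    and c1: "[c = 1] (mod 3)" "[c' = 1] (mod 3)"
    and cop: "coprime c (int p)" "coprime c' (int p)"
    using assms unfolding normalized_rep_def by auto
  have pi: "prime (int p)" using assms by simp
  have q0: "int q > 0" using assms by (simp add: prime_gt_0_nat)
  \<comment> \<open>A product of two values of the form \<open>x\<^sup>2 + 27 * y\<^sup>2\<close>
    has this form again, here with \<open>y = c * e' - c' * e\<close>. Writing
    \<open>y = 2 * q * t\<close> and comparing with \<open>16 * q\<^sup>2\<close> leaves
    \<open>108 * t\<^sup>2\<close> at most 16.\<close>
  have key: "c * e' = c' * e"
    if e: "4 * int q = c\<^sup>2 + 27 * e\<^sup>2" "4 * int q = c'\<^sup>2 + 27 * e'\<^sup>2" and dv: "int q dvd c * e' - c' * e" for e e'
  proof -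
    have par: "even (c\<^sup>2 + 27 * e\<^sup>2)" "even (c'\<^sup>2 + 27 * e'\<^sup>2)"
      using e by (metis dvd_mult2 even_numeral)+
    then have ev: "even (c * e' - c' * e)" by simp blast
    have "odd p" using assms by (simp add: prime_odd_nat)
    then have "coprime 2 (int q)" using assms by simp
    with ev dv have "2 * int q dvd c * e' - c' * e" by (simp add: divides_mult)
    then obtain t where t: "c * e' - c' * e = 2 * int q * t" by (auto simp: dvd_def)
    have "16 * (int q)\<^sup>2 = (4 * int q) * (4 * int q)" by (simp add: power2_eq_square)
    also have "\<dots> = (c\<^sup>2 + 27 * e\<^sup>2) * (c'\<^sup>2 + 27 * e'\<^sup>2)" using e by metis
    also have "\<dots> = (c * c' + 27 * e * e')\<^sup>2 + 27 * (c * e' - c' * e)\<^sup>2"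
      by (simp add: power2_eq_square algebra_simps)
    also have "\<dots> \<ge> 27 * (c * e' - c' * e)\<^sup>2" by simp
    finally have "108 * (int q)\<^sup>2 * t\<^sup>2 \<le> 16 * (int q)\<^sup>2"
      unfolding t by (simp add: power_mult_distrib)
    then have "(int q)\<^sup>2 * (108 * t\<^sup>2) \<le> (int q)\<^sup>2 * 16" by (simp add: mult_ac)
    then have "108 * t\<^sup>2 \<le> 16" using q0 by (subst (asm) mult_le_cancel_left_pos) auto
    then have "t\<^sup>2 < 1" by linarith
    then have "t = 0" by (metis int_one_le_iff_zero_less linorder_not_less zero_less_power2)
    with t show ?thesis by simp
  qed
  have nd: "\<not> int p dvd c" "\<not> int p dvd c'"
    using cop pi by (metis coprime_common_divisor dvd_refl not_prime_unit)+
  have p2: "\<not> int p dvd 2" using assms(2) by (auto dest: zdvd_imp_le)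
  have pd': "\<not> int p dvd d'"
  proof
    assume *: "int p dvd d'"
    have "k > 0" by fact
    then have "int p dvd int q" using assms(3) by (simp add: dvd_power)
    then have "int p dvd 4 * int q - 27 * d'\<^sup>2" using * by (intro dvd_diff dvd_mult) (auto simp: power2_eq_square)
    also have "4 * int q - 27 * d'\<^sup>2 = c'\<^sup>2" using eq by linarith
    finally have "int p dvd c'\<^sup>2" .
    then show False using nd pi prime_dvd_power by blast
  qed
  \<comment> \<open>The second factor is written with \<open>- d\<close> so that \<open>key\<close>
    covers both signs, with \<open>e = d\<close> or \<open>e = - d\<close>.\<close>
  have "int q dvd (c * d' - c' * d) * (c * d' - c' * (- d))"
  proof -
    have "(c * d' - c' * d) * (c * d' - c' * (- d)) = c\<^sup>2 * d'\<^sup>2 - c'\<^sup>2 * d\<^sup>2"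
      by (simp add: power2_eq_square algebra_simps)
    also have "\<dots> = (4 * int q - 27 * d\<^sup>2) * d'\<^sup>2 - (4 * int q - 27 * d'\<^sup>2) * d\<^sup>2"
      using eq by (metis add_diff_cancel_right')
    also have "\<dots> = int q * (4 * d'\<^sup>2 - 4 * d\<^sup>2)" by (simp add: algebra_simps)
    finally show ?thesis by simp
  qed
  moreover have "\<not> (int p dvd c * d' - c' * d \<and> int p dvd c * d' - c' * (- d))"
  proof
    assume "int p dvd c * d' - c' * d \<and> int p dvd c * d' - c' * (- d)"
    then have "int p dvd (c * d' - c' * d) + (c * d' - c' * (- d))" by (intro dvd_add) auto
    then have "int p dvd 2 * (c * d')" by simp
    then show False using p2 nd pd' pi by (auto simp: prime_dvd_mult_iff)
  qed
  \<comment> \<open>As \<open>q\<close> is a power of \<open>p\<close>, a factor prime to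
    \<open>p\<close> is prime to \<open>q\<close>, and all of \<open>q\<close> divides the other
    factor.\<close>
  moreover have "coprime (int q) x" if "\<not> int p dvd x" for x
    using that pi assms(3) by (simp add: prime_imp_coprime)
  ultimately have "int q dvd c * d' - c' * d \<or> int q dvd c * d' - c' * (- d)"
    by (metis coprime_dvd_mult_left_iff coprime_dvd_mult_right_iff)
  then obtain e where e: "e = d \<or> e = - d" "int q dvd c * d' - c' * e" by blast
  have e2: "4 * int q = c\<^sup>2 + 27 * e\<^sup>2" using e eq by auto
  have ce: "c * d' = c' * e" using key[OF e2 eq(2) e(2)] .
  have "4 * int q * c'\<^sup>2 = c\<^sup>2 * c'\<^sup>2 + 27 * (c' * e)\<^sup>2"
    unfolding e2 by (simp add: algebra_simps power2_eq_square)
  also have "\<dots> = c\<^sup>2 * (c'\<^sup>2 + 27 * d'\<^sup>2)"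
    unfolding ce[symmetric] by (simp add: algebra_simps power2_eq_square)
  also have "\<dots> = 4 * int q * c\<^sup>2" using eq by simp
  finally have "c'\<^sup>2 = c\<^sup>2" using q0 by simp
  then have "c' = c \<or> c' = - c" by (simp add: power2_eq_iff)
  moreover have "c' \<noteq> - c"
  proof
    assume "c' = - c"
    then have "c mod 3 = 1" "(- c) mod 3 = 1" using c1 by (auto simp: cong_def)
    then show False by presburger
  qed
  ultimately have "c' = c" by blast
  moreover have "c \<noteq> 0" using nd by auto
  ultimately show ?thesis using ce e by auto
qed

subsection \<open>Power sums over finite fields\<close>

lemma finite_field_power_card_minus_1:
  fixes x :: "'a::{field,finite}"
  assumes "x \<noteq> 0"
  shows "x ^ (CARD('a) - 1) = 1"
proof -
  have "(\<Prod>y\<in>UNIV-{0}. x * y) = x ^ (CARD('a) - 1) * (\<Prod>y\<in>UNIV-{0}. y)"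
    by (simp add: prod.distrib)
  moreover have "(\<Prod>y\<in>UNIV-{0}. x * y) = (\<Prod>y\<in>UNIV-{0}. y)"
    by (rule prod.reindex_bij_witness[of _ "\<lambda>y. y / x" "\<lambda>y. x * y"]) (use assms in auto)
  ultimately show ?thesis by simp
qed

lemma finite_field_CHAR_eq:
  assumes "prime p" "CARD('a::{field,finite}) = p ^ k"
  shows "CHAR('a::{field,finite}) = p"
proof -
  have "CHAR('a) > 0" by (rule finite_imp_CHAR_pos) simp
  then have "prime CHAR('a)" by (rule prime_CHAR_semidom)
  moreover have "CHAR('a) dvd p ^ k" using CHAR_dvd_CARD[where ?'a = 'a] assms by simp
  ultimately show ?thesis using assms(1) by (metis prime_dvd_power primes_dvd_imp_eq)
qed

lemma card_roots_of_unity_le: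
  fixes n :: nat
  assumes "n > 0"
  shows "card {x::'a::{field,finite}. x ^ n = 1} \<le> n"
proof -
  let ?P = "Polynomial.monom (1::'a) n - 1"
  have deg: "degree ?P \<le> n"
    by (intro degree_diff_le) (auto simp: degree_monom_le)
  have "coeff ?P n = 1" using assms by (simp add: coeff_1)
  then have "?P \<noteq> 0" by (metis coeff_0 zero_neq_one)
  then have "card {x. poly ?P x = 0} \<le> degree ?P" by (rule card_poly_roots_bound)
  with deg show ?thesis by (simp add: poly_monom)
qed

lemma finite_field_exists_power_neq_1:
  fixes n :: nat
  assumes "0 < n" "n < CARD('a::{field,finite}) - 1"
  obtains g :: "'a::{field,finite}" where "g \<noteq> 0" "g ^ n \<noteq> 1"
proof -
  have "\<not> (UNIV - {0} \<subseteq> {x::'a. x ^ n = 1})"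
  proof
    assume "UNIV - {0} \<subseteq> {x::'a. x ^ n = 1}"
    then have "card (UNIV - {0::'a}) \<le> card {x::'a. x ^ n = 1}" by (intro card_mono) auto
    with card_roots_of_unity_le[OF assms(1), where ?'a = 'a] assms show False by simp
  qed
  then show ?thesis using that by blast
qed

lemma finite_field_sum_scale:
  fixes f :: "'a::{field,finite} \<Rightarrow> 'b::comm_monoid_add"
  assumes "g \<noteq> 0"
  shows "(\<Sum>x\<in>UNIV. f (g * x)) = (\<Sum>x\<in>UNIV. f x)"
  by (rule sum.reindex_bij_witness[of _ "\<lambda>y. y / g" "\<lambda>y. g * y"]) (use assms in auto)

text \<open>Replacing \<open>x\<close> by \<open>g * x\<close> multiplies the sum by
  \<open>g ^ e\<close>, so it vanishes once some nonzero \<open>g\<close> has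
  \<open>g ^ e \<noteq> 1\<close>. In this range only \<open>e = CARD('a) - 1\<close> admits no such
  \<open>g\<close>; then every nonzero \<open>x\<close> contributes 1.\<close>

lemma finite_field_sum_power:
  fixes e :: nat
  assumes "0 < e" "e < 2 * (CARD('a::{field,finite}) - 1)"
  shows "(\<Sum>x\<in>UNIV. x ^ e) = (if e = CARD('a::{field,finite}) - 1 then - 1 else 0 :: 'a::{field,finite})"
proof (cases "e = CARD('a) - 1")
  case True
  have "(\<Sum>x\<in>UNIV. x ^ e) = (\<Sum>x\<in>UNIV - {0::'a}. x ^ e)"
    using assms by (intro sum.mono_neutral_right) auto
  also have "\<dots> = (\<Sum>x\<in>UNIV - {0::'a}. 1)"
    using True finite_field_power_card_minus_1 by (intro sum.cong) auto
  also have "\<dots> = of_nat (CARD('a) - 1)" by simp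
  also have "\<dots> = of_nat CARD('a) - (1::'a)"
    by (simp add: of_nat_diff Suc_leI)
  also have "of_nat CARD('a) = (0::'a)"
    using CHAR_dvd_CARD[where ?'a = 'a] by (simp add: of_nat_eq_0_iff_char_dvd)
  finally show ?thesis using True by simp
next
  case False
  have "\<exists>g::'a. g \<noteq> 0 \<and> g ^ e \<noteq> 1"
  proof (cases "e < CARD('a) - 1")
    case True
    then show ?thesis using finite_field_exists_power_neq_1[OF assms(1)] by blast
  next
    case F: False
    then have "0 < e - (CARD('a) - 1)" "e - (CARD('a) - 1) < CARD('a) - 1"
      using False assms by auto
    from finite_field_exists_power_neq_1[OF this] obtain g :: 'a
      where g: "g \<noteq> 0" "g ^ (e - (CARD('a) - 1)) \<noteq> 1" by blast
    have "g ^ e = g ^ (e - (CARD('a) - 1)) * g ^ (CARD('a) - 1)"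
      using F by (simp flip: power_add)
    with g show ?thesis using finite_field_power_card_minus_1[OF g(1)] by auto
  qed
  then obtain g :: 'a where g: "g \<noteq> 0" "g ^ e \<noteq> 1" by blast
  have "(\<Sum>x\<in>UNIV. x ^ e) = (\<Sum>x\<in>UNIV. (g * x) ^ e)"
    using finite_field_sum_scale[OF g(1), of "\<lambda>x. x ^ e"] by simp
  also have "\<dots> = g ^ e * (\<Sum>x\<in>UNIV. x ^ e)"
    by (simp add: power_mult_distrib sum_distrib_left)
  finally have "(1 - g ^ e) * (\<Sum>x\<in>UNIV. x ^ e) = 0" by (simp add: algebra_simps)
  with g False show ?thesis by auto
qed

section \<open>Cube roots of unity and cubes in the field\<close>

text \<open>Choosing \<open>\<zeta>\<close> chooses between the two nontrivial cubic characters: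
  \<open>\<zeta>\<close> will correspond to the complex number \<open>\<omega>\<close>. It stays a
  parameter because the non-cubic case needs a choice adapted to the coefficients.\<close>

locale cube_root_field =
  fixes \<zeta> :: "'a::{field,finite}" and m :: nat
  assumes card_eq: "CARD('a) = 3 * m + 1"
    and zeta_cube: "\<zeta> ^ 3 = 1" and zeta_neq_1: "\<zeta> \<noteq> 1"
begin

lemma m_pos: "m > 0"
proof (rule ccontr)
  assume "\<not> m > 0"
  then have "card (UNIV :: 'a set) = 1" using card_eq by simp
  then obtain z :: 'a where "UNIV = {z}" using card_1_singletonE by blast
  then have "(0::'a) = z" "(1::'a) = z" by blast+
  then show False by simp
qed

lemma zeta_neq_0: "\<zeta> \<noteq> 0"
  using zeta_cube by auto

lemma zeta_square: "\<zeta>\<^sup>2 = - 1 - \<zeta>"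
proof -
  have "(\<zeta> - 1) * (\<zeta>\<^sup>2 + \<zeta> + 1) = \<zeta> ^ 3 - 1"
    by (simp add: algebra_simps power2_eq_square power3_eq_cube)
  then have "\<zeta>\<^sup>2 + \<zeta> + 1 = 0" using zeta_cube zeta_neq_1 by simp
  then show ?thesis by (simp add: eq_diff_eq eq_neg_iff_add_eq_0 algebra_simps)
qed

lemma zeta_square_neq: "\<zeta>\<^sup>2 \<noteq> 1" "\<zeta>\<^sup>2 \<noteq> \<zeta>"
proof -
  show "\<zeta>\<^sup>2 \<noteq> \<zeta>" using zeta_neq_0 zeta_neq_1 by (simp add: power2_eq_square)
  show "\<zeta>\<^sup>2 \<noteq> 1"
  proof
    assume "\<zeta>\<^sup>2 = 1"
    then have "\<zeta> ^ 3 = \<zeta>" by (simp add: power3_eq_cube power2_eq_square)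
    then show False using zeta_cube zeta_neq_1 by simp
  qed
qed

lemma cube_root_cases:
  assumes "y ^ 3 = 1"
  shows "y = 1 \<or> y = \<zeta> \<or> y = \<zeta>\<^sup>2"
proof -
  have "(y - 1) * (y - \<zeta>) * (y - \<zeta>\<^sup>2) = y ^ 3 - 1 + (1 - \<zeta> ^ 3) - (\<zeta>\<^sup>2 + \<zeta> + 1) * y\<^sup>2 + (\<zeta>\<^sup>2 + \<zeta> + \<zeta> ^ 3) * y"
    by (simp add: algebra_simps power2_eq_square power3_eq_cube)
  also have "\<dots> = 0" using assms zeta_square zeta_cube by simp
  finally show ?thesis by simp
qed

lemma power_m_cases:
  assumes "x \<noteq> 0"
  shows "x ^ m = 1 \<or> x ^ m = \<zeta> \<or> x ^ m = \<zeta>\<^sup>2"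
proof (rule cube_root_cases)
  have "(x ^ m) ^ 3 = x ^ (CARD('a) - 1)" by (simp add: card_eq mult.commute flip: power_mult)
  then show "(x ^ m) ^ 3 = 1" using finite_field_power_card_minus_1[OF assms] by simp
qed

lemma cube_roots_of_cube:
  assumes "y \<noteq> 0"
  shows "{x. x ^ 3 = y ^ 3} = {y, \<zeta> * y, \<zeta>\<^sup>2 * y}" and "card {x. x ^ 3 = y ^ 3} = 3"
proof -
  show "{x. x ^ 3 = y ^ 3} = {y, \<zeta> * y, \<zeta>\<^sup>2 * y}"
  proof (intro equalityI subsetI)
    fix x assume "x \<in> {x. x ^ 3 = y ^ 3}"
    then have "(x / y) ^ 3 = 1" using assms by (simp add: power_divide)
    then have "x / y = 1 \<or> x / y = \<zeta> \<or> x / y = \<zeta>\<^sup>2" by (rule cube_root_cases)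
    then show "x \<in> {y, \<zeta> * y, \<zeta>\<^sup>2 * y}" using assms by (auto simp: field_simps)
  next
    fix x assume *: "x \<in> {y, \<zeta> * y, \<zeta>\<^sup>2 * y}"
    have "(\<zeta>\<^sup>2) ^ 3 = (\<zeta> ^ 3)\<^sup>2" by (simp flip: power_mult)
    then have "(\<zeta>\<^sup>2) ^ 3 = 1" using zeta_cube by simp
    with * show "x \<in> {x. x ^ 3 = y ^ 3}" using zeta_cube by (auto simp: power_mult_distrib)
  qed
  moreover have "y \<noteq> \<zeta> * y" "y \<noteq> \<zeta>\<^sup>2 * y" "\<zeta> * y \<noteq> \<zeta>\<^sup>2 * y"
    using assms zeta_square_neq zeta_neq_1 by auto
  ultimately show "card {x. x ^ 3 = y ^ 3} = 3" by simp
qed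

text \<open>A count replaces a generator of the multiplicative group: cubing has fibres of size 3 on
  the \<open>3 * m\<close> nonzero elements, so there are \<open>m\<close> nonzero cubes. All of
  them are roots of \<open>x ^ m = 1\<close>, which has at most \<open>m\<close> roots.\<close>

lemma cubic_iff_power_m: "cubic (x::'a) \<longleftrightarrow> x ^ m = 1"
proof -
  let ?C = "(\<lambda>y. y ^ 3) ` (UNIV - {0::'a})"
  have "UNIV - {0} = (\<Union>c\<in>?C. {x. x ^ 3 = c})" by auto
  then have "3 * m = card (\<Union>c\<in>?C. {x. x ^ 3 = c})"
    using card_eq by (metis add_diff_cancel_right' card_Diff_singleton UNIV_I finite_UNIV)
  also have "\<dots> = (\<Sum>c\<in>?C. card {x. x ^ 3 = c})"
    by (rule card_UN_disjoint) auto
  also have "\<dots> = (\<Sum>c\<in>?C. 3)"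
    using cube_roots_of_cube(2) by (intro sum.cong refl) blast
  finally have "card ?C = m" by simp
  moreover have "?C \<subseteq> {x. x ^ m = 1}"
  proof -
    have "(y ^ 3) ^ m = 1" if "y \<noteq> 0" for y :: 'a
      using finite_field_power_card_minus_1[OF that] card_eq by (simp add: power_mult)
    then show ?thesis by auto
  qed
  moreover have "card {x::'a. x ^ m = 1} \<le> m" by (rule card_roots_of_unity_le[OF m_pos])
  ultimately have "?C = {x. x ^ m = 1}" by (intro card_seteq) auto
  then have "x \<in> ?C \<longleftrightarrow> x ^ m = 1" by blast
  then show ?thesis unfolding cubic_def image_iff by blast
qed

subsection \<open>The cubic character\<close>

definition \<omega> :: complex where "\<omega> = Complex (- 1 / 2) (sqrt 3 / 2)"

lemma omega_square: "\<omega>\<^sup>2 = - 1 - \<omega>"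
  by (simp add: \<omega>_def complex_eq_iff power2_eq_square)

lemma omega_cube: "\<omega> ^ 3 = 1"
proof -
  have "\<omega> ^ 3 = \<omega> * \<omega>\<^sup>2" by (simp add: power3_eq_cube power2_eq_square)
  also have "\<dots> = - \<omega> - \<omega>\<^sup>2" by (simp add: omega_square algebra_simps flip: power2_eq_square)
  finally show ?thesis by (simp add: omega_square)
qed

lemma cnj_omega: "cnj \<omega> = \<omega>\<^sup>2"
  unfolding omega_square by (simp add: \<omega>_def complex_eq_iff)

lemma omega_neq: "\<omega> \<noteq> 1" "\<omega>\<^sup>2 \<noteq> 1"
  unfolding omega_square by (auto simp: \<omega>_def complex_eq_iff)

text \<open>The isomorphism from the cube roots of unity in the field to those in the complex
  numbers. The value 0 elsewhere yields \<open>\<chi> 0 = 0\<close>, because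
  \<open>0 ^ m = 0\<close>.\<close>

definition \<phi> :: "'a \<Rightarrow> complex" where
  "\<phi> y = (if y = 1 then 1 else if y = \<zeta> then \<omega> else if y = \<zeta>\<^sup>2 then \<omega>\<^sup>2 else 0)"

definition \<chi> :: "'a \<Rightarrow> complex" where
  "\<chi> x = \<phi> (x ^ m)"

lemma phi_simps [simp]: "\<phi> 1 = 1" "\<phi> \<zeta> = \<omega>" "\<phi> (\<zeta>\<^sup>2) = \<omega>\<^sup>2" "\<phi> 0 = 0"
  using zeta_neq_1 zeta_square_neq zeta_neq_0 by (auto simp: \<phi>_def)

lemma chi_0 [simp]: "\<chi> 0 = 0" and chi_1 [simp]: "\<chi> 1 = 1"
  using m_pos by (simp_all add: \<chi>_def zero_power)

lemma chi_mult: "\<chi> (x * y) = \<chi> x * \<chi> y"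
proof (cases "x = 0 \<or> y = 0")
  case False
  have z: "\<zeta> * \<zeta>\<^sup>2 = 1" "\<zeta>\<^sup>2 * \<zeta> = 1" "\<zeta>\<^sup>2 * \<zeta>\<^sup>2 = \<zeta>" "\<zeta> * \<zeta> = \<zeta>\<^sup>2"
    using zeta_cube by (simp_all add: power3_eq_cube power2_eq_square mult.assoc)
  have w: "\<omega> * \<omega>\<^sup>2 = 1" "\<omega>\<^sup>2 * \<omega> = 1" "\<omega>\<^sup>2 * \<omega>\<^sup>2 = \<omega>" "\<omega> * \<omega> = \<omega>\<^sup>2"
    using omega_cube by (simp_all add: power3_eq_cube power2_eq_square mult.assoc)
  from False have "x \<noteq> 0" "y \<noteq> 0" by auto
  from power_m_cases[OF this(1)] power_m_cases[OF this(2)] show ?thesis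
    unfolding \<chi>_def power_mult_distrib by (elim disjE) (simp_all only: z w phi_simps mult_1 mult_1_right)
qed auto

lemma chi_cube: "x \<noteq> 0 \<Longrightarrow> \<chi> x ^ 3 = 1"
proof -
  assume "x \<noteq> 0"
  have "(\<omega>\<^sup>2) ^ 3 = (\<omega> ^ 3)\<^sup>2" by (simp flip: power_mult)
  then have "(\<omega>\<^sup>2) ^ 3 = 1" by (simp add: omega_cube)
  with power_m_cases[OF \<open>x \<noteq> 0\<close>] show ?thesis
    unfolding \<chi>_def by (elim disjE) (simp_all only: phi_simps omega_cube power_one)
qed

lemma cnj_chi: "cnj (\<chi> x) = (\<chi> x)\<^sup>2"
proof (cases "x = 0")
  case False
  have "cnj (\<omega>\<^sup>2) = (\<omega>\<^sup>2)\<^sup>2" by (simp add: cnj_omega)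
  with power_m_cases[OF False] show ?thesis
    unfolding \<chi>_def by (elim disjE) (simp_all only: phi_simps cnj_omega complex_cnj_one power_one)
qed auto

lemma chi_eq_1_iff: "\<chi> x = 1 \<longleftrightarrow> cubic x"
proof (cases "x = 0")
  case False
  from power_m_cases[OF False] show ?thesis
    unfolding cubic_iff_power_m \<chi>_def
    by (elim disjE) (simp_all add: omega_neq zeta_neq_1 zeta_square_neq)
qed (auto simp: cubic_def)

lemma chi_values: "x \<noteq> 0 \<Longrightarrow> \<chi> x = 1 \<or> \<chi> x = \<omega> \<or> \<chi> x = \<omega>\<^sup>2"
  using power_m_cases[of x] unfolding \<chi>_def by (metis phi_simps(1-3))

lemma chi_sum_square:
  assumes "x \<noteq> 0"
  shows "\<chi> x + (\<chi> x)\<^sup>2 = (if cubic x then 2 else - 1)"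
proof -
  have "(\<omega>\<^sup>2)\<^sup>2 = \<omega>" using omega_cube by (simp add: power3_eq_cube power2_eq_square mult.assoc)
  then show ?thesis using chi_values[OF assms] chi_eq_1_iff[of x] omega_neq
    by (auto simp: omega_square)
qed

lemma chi_minus: "\<chi> (- x) = \<chi> x"
proof -
  have "cubic (- 1 :: 'a)" unfolding cubic_def by (intro exI[of _ "- 1"]) simp
  then have "\<chi> (- 1) = 1" by (simp add: chi_eq_1_iff)
  then show ?thesis using chi_mult[of "- 1" x] by simp
qed

lemma card_cube_roots: "of_nat (card {y. y ^ 3 = x}) = 1 + \<chi> x + (\<chi> x)\<^sup>2"
proof (cases "x = 0")
  case True
  then have "{y. y ^ 3 = x} = {0}" by auto
  then show ?thesis using True by simp
next
  case False
  show ?thesis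
  proof (cases "cubic x")
    case True
    then obtain y where "y \<noteq> 0" "x = y ^ 3" unfolding cubic_def by blast
    then show ?thesis using cube_roots_of_cube(2) chi_sum_square[OF False] True
      by (simp add: add.assoc)
  next
    case nc: False
    then have "{y. y ^ 3 = x} = {}" using False unfolding cubic_def by auto
    then show ?thesis using chi_sum_square[OF False] nc by (simp add: add.assoc)
  qed
qed

lemma sum_chi: "(\<Sum>x\<in>UNIV. \<chi> x) = 0"
proof -
  obtain g :: 'a where g: "g \<noteq> 0" "g ^ m \<noteq> 1"
    using finite_field_exists_power_neq_1[OF m_pos, where ?'a = 'a] card_eq m_pos by auto
  then have "\<chi> g \<noteq> 1" by (simp add: chi_eq_1_iff cubic_iff_power_m)
  have "(\<Sum>x\<in>UNIV. \<chi> x) = (\<Sum>x\<in>UNIV. \<chi> (g * x))"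
    using finite_field_sum_scale[OF g(1), of \<chi>] by simp
  also have "\<dots> = \<chi> g * (\<Sum>x\<in>UNIV. \<chi> x)" by (simp add: chi_mult sum_distrib_left)
  finally have "(1 - \<chi> g) * (\<Sum>x\<in>UNIV. \<chi> x) = 0" by (simp add: algebra_simps)
  with \<open>\<chi> g \<noteq> 1\<close> show ?thesis by simp
qed

lemma sum_chi_square: "(\<Sum>x\<in>UNIV. (\<chi> x)\<^sup>2) = 0"
  using arg_cong[OF sum_chi, of cnj] by (simp add: cnj_chi)

lemma sum_reflect: "(\<Sum>x\<in>UNIV. f (1 - x)) = (\<Sum>x\<in>UNIV. f (x::'a))"
  by (rule sum.reindex_bij_witness[of _ "\<lambda>x. 1 - x" "\<lambda>x. 1 - x"]) auto

text \<open>For \<open>s = inverse t\<close>, \<open>\<chi> t ^ 3 = 1\<close> turns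
  \<open>(\<chi> t)\<^sup>2 * \<chi> (1 - t)\<close> into \<open>\<chi> (s - 1)\<close>. Over
  nonzero \<open>s\<close> this is a full character sum, which is 0, without its term
  \<open>\<chi> (- 1) = 1\<close>.\<close>

lemma sum_chi_chi_square: "(\<Sum>t\<in>UNIV. \<chi> t * (\<chi> (1 - t))\<^sup>2) = - 1"
  and sum_chi_square_chi: "(\<Sum>t\<in>UNIV. (\<chi> t)\<^sup>2 * \<chi> (1 - t)) = - 1"
proof -
  have "(\<Sum>t\<in>UNIV. (\<chi> t)\<^sup>2 * \<chi> (1 - t)) = (\<Sum>t\<in>UNIV - {0}. (\<chi> t)\<^sup>2 * \<chi> (1 - t))"
    by (intro sum.mono_neutral_right) auto
  also have "\<dots> = (\<Sum>s\<in>UNIV - {0}. \<chi> (s - 1))"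
  proof (rule sum.reindex_bij_witness[of _ inverse inverse])
    fix t :: 'a assume "t \<in> UNIV - {0}"
    then have t: "t \<noteq> 0" by simp
    have "\<chi> (inverse t - 1) = \<chi> t ^ 3 * \<chi> (inverse t - 1)" using chi_cube[OF t] by simp
    also have "\<dots> = (\<chi> t)\<^sup>2 * \<chi> (t * (inverse t - 1))"
      unfolding chi_mult by (simp add: power3_eq_cube power2_eq_square)
    also have "t * (inverse t - 1) = 1 - t" using t by (simp add: algebra_simps)
    finally show "\<chi> (inverse t - 1) = (\<chi> t)\<^sup>2 * \<chi> (1 - t)" .
  qed auto
  also have "\<dots> = (\<Sum>s\<in>UNIV. \<chi> (s - 1)) - \<chi> (0 - 1)"
    by (subst sum_diff1) auto
  also have "(\<Sum>s\<in>UNIV. \<chi> (s - 1)) = (\<Sum>s\<in>UNIV. \<chi> s)"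
    by (rule sum.reindex_bij_witness[of _ "\<lambda>x. x + 1" "\<lambda>x. x - 1"]) auto
  finally show *: "(\<Sum>t\<in>UNIV. (\<chi> t)\<^sup>2 * \<chi> (1 - t)) = - 1"
    using chi_minus[of 1] by (simp add: sum_chi)
  have "(\<Sum>t\<in>UNIV. \<chi> t * (\<chi> (1 - t))\<^sup>2) = (\<Sum>t\<in>UNIV. (\<chi> t)\<^sup>2 * \<chi> (1 - t))"
    using sum_reflect[of "\<lambda>t. (\<chi> t)\<^sup>2 * \<chi> (1 - t)"] by (simp add: mult.commute)
  with * show "(\<Sum>t\<in>UNIV. \<chi> t * (\<chi> (1 - t))\<^sup>2) = - 1" by simp
qed

subsection \<open>The Jacobi sum\<close>

definition J :: complex where
  "J = (\<Sum>t\<in>UNIV. \<chi> t * \<chi> (1 - t))"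

lemma cnj_J: "cnj J = (\<Sum>t\<in>UNIV. (\<chi> t)\<^sup>2 * (\<chi> (1 - t))\<^sup>2)"
  by (simp add: J_def cnj_chi)

text \<open>The correlation of two shifts of \<open>\<chi>\<close>. For \<open>x = z\<close> each
  nonzero argument contributes 1; otherwise translating by \<open>x\<close> and scaling by
  \<open>z - x\<close> reduces to the sum of
  \<open>\<chi> s * (\<chi> (1 - s))\<^sup>2\<close>.\<close>

lemma sum_chi_shift:
  "(\<Sum>s\<in>UNIV. \<chi> (s - x) * (\<chi> (s - z))\<^sup>2) = (if x = z then of_nat CARD('a) else 0) - 1"
proof -
  have "(\<Sum>s\<in>UNIV. \<chi> (s - x) * (\<chi> (s - z))\<^sup>2) = (\<Sum>s\<in>UNIV. \<chi> s * (\<chi> (s + (x - z)))\<^sup>2)"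
    by (rule sum.reindex_bij_witness[of _ "\<lambda>s. s + x" "\<lambda>s. s - x"]) (auto simp: algebra_simps)
  also have "\<dots> = (if x = z then of_nat CARD('a) else 0) - 1"
  proof (cases "x = z")
    case True
    have "(\<Sum>s\<in>UNIV. \<chi> s * (\<chi> (s + (x - z)))\<^sup>2) = (\<Sum>s\<in>UNIV - {0}. \<chi> s * (\<chi> s)\<^sup>2)"
      using True by (intro sum.mono_neutral_cong_right) auto
    also have "\<dots> = (\<Sum>s\<in>UNIV - {0::'a}. 1)"
      using chi_cube by (intro sum.cong) (auto simp: power3_eq_cube power2_eq_square mult.assoc)
    also have "\<dots> = of_nat CARD('a) - 1" by (simp add: of_nat_diff Suc_leI)
    finally show ?thesis using True by simp
  next
    case False
    define t where "t = x - z"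
    have t: "t \<noteq> 0" using False by (simp add: t_def)
    have "(\<Sum>s\<in>UNIV. \<chi> s * (\<chi> (s + t))\<^sup>2) = (\<Sum>s\<in>UNIV. \<chi> (- t * s) * (\<chi> (- t * s + t))\<^sup>2)"
      using finite_field_sum_scale[of "- t" "\<lambda>s. \<chi> s * (\<chi> (s + t))\<^sup>2"] t by simp
    also have "\<dots> = (\<Sum>s\<in>UNIV. \<chi> s * (\<chi> (1 - s))\<^sup>2)"
    proof (rule sum.cong)
      fix s :: 'a
      have "\<chi> (- t * s) = \<chi> t * \<chi> s" using chi_mult[of "- t" s] chi_minus[of t] by simp
      moreover have "\<chi> (- t * s + t) = \<chi> t * \<chi> (1 - s)"
        using chi_mult[of t "1 - s"] by (simp add: algebra_simps)
      ultimately have "\<chi> (- t * s) * (\<chi> (- t * s + t))\<^sup>2 = \<chi> t ^ 3 * (\<chi> s * (\<chi> (1 - s))\<^sup>2)"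
        by (simp add: power2_eq_square power3_eq_cube)
      then show "\<chi> (- t * s) * (\<chi> (- t * s + t))\<^sup>2 = \<chi> s * (\<chi> (1 - s))\<^sup>2"
        using chi_cube[OF t] by simp
    qed auto
    finally show ?thesis using False sum_chi_chi_square by (simp add: t_def)
  qed
  finally show ?thesis .
qed

text \<open>
  Evaluate \<open>\<Sum>\<^sub>s \<bar>\<Sum>\<^sub>x \<chi>(x) \<chi>(s - x)\<bar>\<^sup>2\<close> twice: by scaling the inner sum is \<open>\<chi>(s)\<^sup>2 J\<close>, and it vanishes
  for \<open>s = 0\<close>; on the other hand, one can sum over \<open>s\<close> first. This avoids Gauss sums.
\<close>

lemma J_norm: "J * cnj J = of_nat CARD('a)"
proof -
  define K where "K s = (\<Sum>x\<in>UNIV. \<chi> x * \<chi> (s - x))" for s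
  let ?q = "of_nat CARD('a) :: complex"
  have K0: "K 0 = 0"
    using sum_chi_square by (simp add: K_def chi_minus power2_eq_square)
  have Ks: "K s * cnj (K s) = J * cnj J" if "s \<noteq> 0" for s
  proof -
    have "K s = (\<Sum>x\<in>UNIV. \<chi> (s * x) * \<chi> (s - s * x))"
      unfolding K_def using finite_field_sum_scale[OF that, of "\<lambda>x. \<chi> x * \<chi> (s - x)"] by simp
    also have "\<dots> = (\<Sum>x\<in>UNIV. (\<chi> s)\<^sup>2 * (\<chi> x * \<chi> (1 - x)))"
    proof (rule sum.cong)
      fix x
      have "\<chi> (s - s * x) = \<chi> s * \<chi> (1 - x)" using chi_mult[of s "1 - x"] by (simp add: algebra_simps)
      then show "\<chi> (s * x) * \<chi> (s - s * x) = (\<chi> s)\<^sup>2 * (\<chi> x * \<chi> (1 - x))"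
        by (simp add: chi_mult power2_eq_square)
    qed auto
    also have "\<dots> = (\<chi> s)\<^sup>2 * J" by (simp add: J_def sum_distrib_left)
    finally have "K s * cnj (K s) = ((\<chi> s) ^ 3)\<^sup>2 * (J * cnj J)"
      by (simp add: cnj_chi power2_eq_square power3_eq_cube)
    then show ?thesis using chi_cube[OF that] by simp
  qed
  have "(?q - 1) * (J * cnj J) = (\<Sum>s\<in>UNIV - {0::'a}. J * cnj J)"
    by (simp add: of_nat_diff Suc_leI)
  also have "\<dots> = (\<Sum>s\<in>UNIV. K s * cnj (K s))"
    using K0 Ks by (intro sum.mono_neutral_cong_left) auto
  also have "\<dots> = (\<Sum>s\<in>UNIV. \<Sum>x\<in>UNIV. \<Sum>z\<in>UNIV. (\<chi> x * (\<chi> z)\<^sup>2) * (\<chi> (s - x) * (\<chi> (s - z))\<^sup>2))"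
    unfolding K_def cnj_sum complex_cnj_mult cnj_chi sum_product by (simp add: mult_ac)
  also have "\<dots> = (\<Sum>x\<in>UNIV. \<Sum>z\<in>UNIV. \<Sum>s\<in>UNIV. (\<chi> x * (\<chi> z)\<^sup>2) * (\<chi> (s - x) * (\<chi> (s - z))\<^sup>2))"
    by (subst sum.swap, rule sum.cong[OF refl], rule sum.swap)
  also have "\<dots> = (\<Sum>x\<in>UNIV. \<Sum>z\<in>UNIV. (\<chi> x * (\<chi> z)\<^sup>2) * ((if x = z then ?q else 0) - 1))"
    by (simp only: sum_distrib_left[symmetric] sum_chi_shift)
  \<comment> \<open>Only the diagonal \<open>x = z\<close> will survive, since the contribution of
    \<open>- 1\<close> contains the vanishing sum of \<open>(\<chi> z)\<^sup>2\<close>.\<close>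
  also have "\<dots> = (\<Sum>x\<in>UNIV. \<chi> x * (\<chi> x)\<^sup>2 * ?q - \<chi> x * (\<Sum>z\<in>UNIV. (\<chi> z)\<^sup>2))"
  proof (rule sum.cong)
    fix x
    have "(\<Sum>z\<in>UNIV. (\<chi> x * (\<chi> z)\<^sup>2) * ((if x = z then ?q else 0) - 1))
        = (\<Sum>z\<in>UNIV. (if x = z then \<chi> x * (\<chi> z)\<^sup>2 * ?q else 0) - \<chi> x * (\<chi> z)\<^sup>2)"
      by (intro sum.cong) (auto simp: algebra_simps)
    also have "\<dots> = \<chi> x * (\<chi> x)\<^sup>2 * ?q - \<chi> x * (\<Sum>z\<in>UNIV. (\<chi> z)\<^sup>2)"
      by (simp add: sum_subtractf sum_distrib_left)
    finally show "(\<Sum>z\<in>UNIV. (\<chi> x * (\<chi> z)\<^sup>2) * ((if x = z then ?q else 0) - 1))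
        = \<chi> x * (\<chi> x)\<^sup>2 * ?q - \<chi> x * (\<Sum>z\<in>UNIV. (\<chi> z)\<^sup>2)" .
  qed auto
  also have "\<dots> = (\<Sum>x\<in>UNIV. \<chi> x * (\<chi> x)\<^sup>2) * ?q"
    by (simp add: sum_chi_square sum_distrib_right)
  also have "\<dots> = (?q - 1) * ?q" using sum_chi_shift[of 0 0] by simp
  finally have "(?q - 1) * (J * cnj J) = (?q - 1) * ?q" .
  moreover have "?q - 1 \<noteq> 0" using card_eq m_pos by (simp add: of_nat_eq_iff)
  ultimately show ?thesis by simp
qed

section \<open>Integer coordinates of the Jacobi sum and its reductions\<close>

text \<open>\<open>jacobi_u\<close> and \<open>jacobi_v\<close> collect the coordinates with respect
  to 1 and \<open>\<rho>\<close> of one third of each nonzero product: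
  \<open>(1 - \<rho>)\<^sup>2 = - 3 * \<rho>\<close>,
  \<open>(1 - \<rho>) * (1 - \<rho>\<^sup>2) = 3\<close> and
  \<open>(1 - \<rho>\<^sup>2)\<^sup>2 = 3 + 3 * \<rho>\<close>.\<close>

definition jacobi_u :: int where
  "jacobi_u = (\<Sum>t\<in>UNIV. if (t ^ m = \<zeta> \<or> t ^ m = \<zeta>\<^sup>2) \<and> ((1 - t) ^ m = \<zeta> \<or> (1 - t) ^ m = \<zeta>\<^sup>2)
     \<and> \<not> (t ^ m = \<zeta> \<and> (1 - t) ^ m = \<zeta>) then 1 else 0)"

definition jacobi_v :: int where
  "jacobi_v = (\<Sum>t\<in>UNIV. if t ^ m = \<zeta>\<^sup>2 \<and> (1 - t) ^ m = \<zeta>\<^sup>2 then 1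
     else if t ^ m = \<zeta> \<and> (1 - t) ^ m = \<zeta> then - 1 else 0)"

text \<open>
  The sum of \<open>(1 - \<psi>(t\<^sup>m)) (1 - \<psi>((1 - t)\<^sup>m))\<close> has terms in \<open>3 \<int>[\<rho>]\<close>, because \<open>3\<close> is associated
  to \<open>(1 - \<rho>)\<^sup>2\<close>. The same integer coefficients arise for a Jacobi sum in \<open>\<complex>\<close> and for its reductions
  modulo the primes above \<open>p\<close>, which live in the finite field itself.
\<close>

lemma jacobi_sum_decomposition:
  fixes \<psi> :: "'a \<Rightarrow> 'b::comm_ring_1"
  assumes \<psi>: "\<psi> 0 = 0" "\<psi> 1 = 1" "\<psi> \<zeta> = \<rho>" "\<psi> (\<zeta>\<^sup>2) = \<rho>\<^sup>2" and \<rho>: "\<rho>\<^sup>2 = - 1 - \<rho>"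
    and sum0: "(\<Sum>t\<in>UNIV. \<psi> (t ^ m)) = 0"
  shows "(\<Sum>t\<in>UNIV. \<psi> (t ^ m) * \<psi> ((1 - t) ^ m))
    = 3 * (of_int jacobi_u + of_int jacobi_v * \<rho>) - of_nat CARD('a)"
proof -
  have r: "\<rho> * \<rho> = - 1 - \<rho>" using \<rho> by (simp add: power2_eq_square)
  have *: "(1 - \<psi> (t ^ m)) * (1 - \<psi> ((1 - t) ^ m)) =
     3 * (of_int (if (t ^ m = \<zeta> \<or> t ^ m = \<zeta>\<^sup>2) \<and> ((1 - t) ^ m = \<zeta> \<or> (1 - t) ^ m = \<zeta>\<^sup>2)
         \<and> \<not> (t ^ m = \<zeta> \<and> (1 - t) ^ m = \<zeta>) then 1 else 0)
       + of_int (if t ^ m = \<zeta>\<^sup>2 \<and> (1 - t) ^ m = \<zeta>\<^sup>2 then 1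
         else if t ^ m = \<zeta> \<and> (1 - t) ^ m = \<zeta> then - 1 else 0) * \<rho>)" for t
  proof (cases "t = 0 \<or> t = 1")
    case True
    then show ?thesis using m_pos \<psi> zeta_neq_0 zeta_neq_1 zeta_square_neq by auto
  next
    case False
    then have t: "t \<noteq> 0" "1 - t \<noteq> 0" by auto
    show ?thesis
      using power_m_cases[OF t(1)] power_m_cases[OF t(2)] zeta_neq_1 zeta_square_neq
      by (elim disjE) (simp_all add: \<psi> \<rho> r algebra_simps)
  qed
  have s1: "(\<Sum>t\<in>UNIV. \<psi> ((1 - t) ^ m)) = 0"
    using sum_reflect[of "\<lambda>t. \<psi> (t ^ m)"] sum0 by simp
  have "(\<Sum>t\<in>UNIV. (1 - \<psi> (t ^ m)) * (1 - \<psi> ((1 - t) ^ m)))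
      = (\<Sum>t\<in>UNIV. 1 - \<psi> (t ^ m) - \<psi> ((1 - t) ^ m) + \<psi> (t ^ m) * \<psi> ((1 - t) ^ m))"
    by (intro sum.cong) (auto simp: algebra_simps)
  also have "\<dots> = of_nat CARD('a) + (\<Sum>t\<in>UNIV. \<psi> (t ^ m) * \<psi> ((1 - t) ^ m))"
    using sum0 s1 by (simp add: sum.distrib sum_subtractf)
  finally have "(\<Sum>t\<in>UNIV. (1 - \<psi> (t ^ m)) * (1 - \<psi> ((1 - t) ^ m)))
      = of_nat CARD('a) + (\<Sum>t\<in>UNIV. \<psi> (t ^ m) * \<psi> ((1 - t) ^ m))" .
  moreover have "(\<Sum>t\<in>UNIV. (1 - \<psi> (t ^ m)) * (1 - \<psi> ((1 - t) ^ m)))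
      = 3 * (of_int jacobi_u + of_int jacobi_v * \<rho>)"
    unfolding * jacobi_u_def jacobi_v_def of_int_sum
    by (simp only: sum_distrib_left[symmetric] sum_distrib_right[symmetric] sum.distrib)
  ultimately show ?thesis by (simp add: algebra_simps)
qed

lemma J_eq: "J = 3 * (of_int jacobi_u + of_int jacobi_v * \<omega>) - of_nat CARD('a)"
  unfolding J_def \<chi>_def using sum_chi
  by (intro jacobi_sum_decomposition omega_square) (auto simp: \<chi>_def)

text \<open>After binomial expansion all exponents lie strictly between 0 and twice
  \<open>CARD('a) - 1\<close>, so only the power sum with exponent \<open>3 * m\<close>
  survives.\<close>

lemma sum_power_mult_power_reflect:
  fixes a b :: nat
  assumes "0 < a" "a + b < 2 * (3 * m)"
  shows "(\<Sum>t\<in>UNIV. t ^ a * (1 - t) ^ b)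
    = (\<Sum>j\<le>b. of_nat (b choose j) * (- 1) ^ j * (if a + j = 3 * m then - 1 else 0 :: 'a))"
proof -
  have "(\<Sum>t\<in>UNIV. t ^ a * (1 - t) ^ b)
      = (\<Sum>t\<in>UNIV. \<Sum>j\<le>b. of_nat (b choose j) * (- 1) ^ j * (t::'a) ^ (a + j))"
  proof (rule sum.cong)
    fix t :: 'a
    have "(1 - t) ^ b = (- t + 1) ^ b" by simp
    also have "\<dots> = (\<Sum>j\<le>b. of_nat (b choose j) * (- t) ^ j * 1 ^ (b - j))" by (rule binomial_ring)
    also have "\<dots> = (\<Sum>j\<le>b. of_nat (b choose j) * (- 1) ^ j * t ^ j)"
      by (intro sum.cong) (simp_all add: power_minus[of t])
    finally show "t ^ a * (1 - t) ^ b = (\<Sum>j\<le>b. of_nat (b choose j) * (- 1) ^ j * t ^ (a + j))"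
      by (simp add: sum_distrib_left power_add mult_ac)
  qed simp
  also have "\<dots> = (\<Sum>j\<le>b. of_nat (b choose j) * (- 1) ^ j * (\<Sum>t\<in>UNIV. (t::'a) ^ (a + j)))"
    by (subst sum.swap) (simp add: sum_distrib_left)
  also have "\<dots> = (\<Sum>j\<le>b. of_nat (b choose j) * (- 1) ^ j * (if a + j = 3 * m then - 1 else 0 :: 'a))"
  proof (intro sum.cong refl)
    fix j assume "j \<in> {..b}"
    then show "of_nat (b choose j) * (- 1) ^ j * (\<Sum>t\<in>UNIV. (t::'a) ^ (a + j))
        = of_nat (b choose j) * (- 1) ^ j * (if a + j = 3 * m then - 1 else 0 :: 'a)"
      using assms finite_field_sum_power[where ?'a = 'a, of "a + j"] card_eq by simp
  qed
  finally show ?thesis .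
qed

lemma of_nat_card_eq_0: "of_nat CARD('a) = (0::'a)"
  using CHAR_dvd_CARD[where ?'a = 'a] by (simp add: of_nat_eq_0_iff_char_dvd)

text \<open>The reduction of \<open>J\<close> with \<open>\<omega>\<close> sent to
  \<open>\<zeta>\<close>, where the character becomes \<open>x ^ m\<close>. The expanded exponents
  are at most \<open>2 * m\<close>, so none reaches \<open>3 * m\<close>.\<close>

lemma jacobi_mod_zeta: "3 * (of_int jacobi_u + of_int jacobi_v * \<zeta>) = 0"
proof -
  have "(\<Sum>t\<in>UNIV. t ^ m) = (0::'a)"
    using finite_field_sum_power[where ?'a = 'a, of m] card_eq m_pos by simp
  then have "(\<Sum>t\<in>UNIV. t ^ m * (1 - t) ^ m)
      = 3 * (of_int jacobi_u + of_int jacobi_v * \<zeta>) - of_nat CARD('a)"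
    using jacobi_sum_decomposition[of "\<lambda>x. x" \<zeta>] zeta_square by simp
  moreover have "(\<Sum>t\<in>UNIV. t ^ m * (1 - t) ^ m) = (0::'a)"
    using m_pos by (subst sum_power_mult_power_reflect) (auto intro!: sum.neutral)
  ultimately show ?thesis by (simp only: of_nat_card_eq_0 diff_0_right)
qed

text \<open>The other reduction, with \<open>\<omega>\<close> sent to \<open>\<zeta>\<^sup>2\<close>
  and the character to \<open>x ^ (2 * m)\<close>. The exponent \<open>2 * m + j\<close> equals
  \<open>3 * m\<close> exactly for \<open>j = m\<close>, which leaves the central binomial
  coefficient.\<close>

lemma jacobi_mod_zeta_square:
  "3 * (of_int jacobi_u + of_int jacobi_v * \<zeta>\<^sup>2) = - ((- 1) ^ m * of_nat ((2 * m) choose m))"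
proof -
  have "(\<Sum>t\<in>UNIV. t ^ (2 * m)) = (0::'a)"
    using finite_field_sum_power[where ?'a = 'a, of "2 * m"] card_eq m_pos by simp
  then have "(\<Sum>t\<in>UNIV. (t ^ m)\<^sup>2) = (0::'a)"
    by (simp add: mult.commute flip: power_mult)
  moreover have "(\<zeta>\<^sup>2)\<^sup>2 = - 1 - \<zeta>\<^sup>2"
  proof -
    have "(\<zeta>\<^sup>2)\<^sup>2 = \<zeta> ^ 3 * \<zeta>" by (simp add: power2_eq_square power3_eq_cube)
    then show ?thesis by (simp add: zeta_cube zeta_square)
  qed
  ultimately have "(\<Sum>t\<in>UNIV. (t ^ m)\<^sup>2 * ((1 - t) ^ m)\<^sup>2)
      = 3 * (of_int jacobi_u + of_int jacobi_v * \<zeta>\<^sup>2) - of_nat CARD('a)"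
    by (intro jacobi_sum_decomposition) auto
  moreover have "(\<Sum>t\<in>UNIV. t ^ (2 * m) * (1 - t) ^ (2 * m)) = - ((- 1) ^ m * of_nat ((2 * m) choose m) :: 'a)"
  proof -
    have "(\<Sum>t\<in>UNIV. t ^ (2 * m) * (1 - t) ^ (2 * m))
        = (\<Sum>j\<le>2 * m. of_nat ((2 * m) choose j) * (- 1) ^ j * (if 2 * m + j = 3 * m then - 1 else (0::'a)))"
      using m_pos by (intro sum_power_mult_power_reflect) auto
    also have "\<dots> = (\<Sum>j\<le>2 * m. if j = m then - (of_nat ((2 * m) choose j) * (- 1) ^ j) else 0)"
      by (intro sum.cong) auto
    also have "\<dots> = - (of_nat ((2 * m) choose m) * (- 1) ^ m)" by (subst sum.delta) auto
    finally show ?thesis by (simp add: mult.commute)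
  qed
  ultimately show ?thesis
    by (simp only: of_nat_card_eq_0 diff_0_right power_mult[symmetric] mult.commute[of m 2])
qed

section \<open>The representation of four times the field size\<close>

text \<open>This is the trace \<open>J + cnj J\<close>.\<close>

definition rep_c :: int where "rep_c = 3 * (2 * jacobi_u - jacobi_v) - 2 * int CARD('a)"

text \<open>In the field the trace is the sum of both reductions, the first of which is 0. Reducing
  \<open>J - cnj J = 3 * jacobi_v * (2 * \<omega> + 1)\<close> therefore gives
  \<open>- rep_c = 3 * jacobi_v * (2 * \<zeta> + 1)\<close>, and
  \<open>(2 * \<zeta> + 1)\<^sup>2 = - 3\<close> yields the second claim.\<close>

lemma rep_c_mod:
  "(of_int rep_c :: 'a) = - ((- 1) ^ m * of_nat ((2 * m) choose m))"
  "of_int (9 * jacobi_v) = of_int rep_c * (2 * \<zeta> + 1)"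
proof -
  have q: "of_int rep_c = 3 * (2 * of_int jacobi_u - of_int jacobi_v :: 'a)"
    using of_nat_card_eq_0 by (simp add: rep_c_def)
  have "of_int rep_c = 3 * (of_int jacobi_u + of_int jacobi_v * \<zeta>)
      + 3 * (of_int jacobi_u + of_int jacobi_v * \<zeta>\<^sup>2)"
    unfolding q zeta_square by (simp add: algebra_simps)
  then show "(of_int rep_c :: 'a) = - ((- 1) ^ m * of_nat ((2 * m) choose m))"
    unfolding jacobi_mod_zeta jacobi_mod_zeta_square by simp
  have "of_int rep_c * (2 * \<zeta> + 1) = 2 * (2 * \<zeta> + 1) * (3 * (of_int jacobi_u + of_int jacobi_v * \<zeta>))
      - 3 * of_int jacobi_v * (4 * \<zeta>\<^sup>2 + 4 * \<zeta> + 1)"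
    unfolding q by (simp add: algebra_simps power2_eq_square)
  also have "\<dots> = of_int (9 * jacobi_v)"
    unfolding jacobi_mod_zeta zeta_square by (simp add: algebra_simps)
  finally show "of_int (9 * jacobi_v) = of_int rep_c * (2 * \<zeta> + 1)" by simp
qed

text \<open>For \<open>J = A + B * \<omega>\<close> the norm is
  \<open>A\<^sup>2 - A * B + B\<^sup>2\<close>, and four times it is
  \<open>(2 * A - B)\<^sup>2 + 3 * B\<^sup>2\<close>. Divisibility of \<open>B\<close> by 3 produces
  the coefficient 27.\<close>

lemma four_card_eq: "4 * int CARD('a) = rep_c\<^sup>2 + 27 * jacobi_v\<^sup>2"
proof -
  define A where "A = 3 * jacobi_u - int CARD('a)"
  define B where "B = 3 * jacobi_v"
  have J: "J = of_int A + of_int B * \<omega>" by (simp add: J_eq A_def B_def algebra_simps)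
  have "of_int (int CARD('a)) = J * cnj J" by (simp add: J_norm)
  also have "\<dots> = of_int A * of_int A + of_int A * of_int B * (\<omega> + \<omega>\<^sup>2) + of_int B * of_int B * \<omega> ^ 3"
    unfolding J by (simp add: cnj_omega algebra_simps power2_eq_square power3_eq_cube)
  also have "\<dots> = of_int (A * A - A * B + B * B)"
    by (simp add: omega_square omega_cube)
  finally have "int CARD('a) = A * A - A * B + B * B" by (simp only: of_int_eq_iff)
  moreover have "rep_c = 2 * A - B" by (simp add: rep_c_def A_def B_def)
  ultimately have "4 * int CARD('a) = rep_c\<^sup>2 + 3 * B\<^sup>2"
    by (simp only: power2_eq_square) (simp add: algebra_simps)
  then show ?thesis by (simp add: B_def power_mult_distrib)
qed

lemma rep_c_cong_1: "[rep_c = 1] (mod 3)"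
proof -
  have "rep_c = 1 + 3 * (2 * jacobi_u - jacobi_v - 2 * int m - 1)"
    by (simp add: rep_c_def card_eq)
  then show ?thesis by (metis cong_add_lcancel_0 cong_mult_self_left)
qed

section \<open>Counting the solutions through the Jacobi sum\<close>

text \<open>Solutions are sorted by \<open>t = a1 * x1 ^ 3 / a3\<close>, which makes
  \<open>a2 * x2 ^ 3 / a3 = 1 - t\<close>. Counting cube roots on both sides gives nine character
  sums: the constant one, four that vanish, two equal to \<open>- 1\<close>, and \<open>J\<close>
  with its conjugate.\<close>

lemma N_eq:
  assumes a: "a1 \<noteq> 0" "a2 \<noteq> 0" "a3 \<noteq> (0::'a)"
  defines "A \<equiv> \<chi> (a1 * a2 * a3)" and "B \<equiv> \<chi> (a1 * inverse a2)"
  shows "of_nat (N a1 a2 a3) = of_nat CARD('a) + A\<^sup>2 * J + A * cnj J - (B + B\<^sup>2)"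
proof -
  define \<alpha> where "\<alpha> = \<chi> (a3 * inverse a1)"
  define \<beta> where "\<beta> = \<chi> (a3 * inverse a2)"
  let ?X = "\<lambda>t. {x. x ^ 3 = a3 * inverse a1 * t}"
  let ?Y = "\<lambda>t. {x. x ^ 3 = a3 * inverse a2 * (1 - t)}"
  have "{(x1, x2). a1 * x1 ^ 3 + a2 * x2 ^ 3 = a3} = (\<Union>t. ?X t \<times> ?Y t)"
  proof (intro equalityI subsetI)
    fix z assume "z \<in> {(x1, x2). a1 * x1 ^ 3 + a2 * x2 ^ 3 = a3}"
    then obtain x y where z: "z = (x, y)" "a1 * x ^ 3 + a2 * y ^ 3 = a3" by blast
    define t where "t = a1 * x ^ 3 / a3"
    have "x ^ 3 = a3 * inverse a1 * t" using a by (simp add: t_def field_simps)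
    moreover have "a2 * y ^ 3 = a3 * (1 - t)" using z(2)[symmetric] a by (simp add: t_def right_diff_distrib)
    then have "y ^ 3 = a3 * inverse a2 * (1 - t)" using a by (simp add: field_simps)
    ultimately show "z \<in> (\<Union>t. ?X t \<times> ?Y t)" using z by auto
  next
    fix z assume "z \<in> (\<Union>t. ?X t \<times> ?Y t)"
    then obtain x y t where z: "z = (x, y)" "x ^ 3 = a3 * inverse a1 * t" "y ^ 3 = a3 * inverse a2 * (1 - t)"
      by blast
    have "a1 * x ^ 3 + a2 * y ^ 3 = a3" unfolding z using a by (simp add: field_simps)
    then show "z \<in> {(x1, x2). a1 * x1 ^ 3 + a2 * x2 ^ 3 = a3}" using z by simp
  qed
  then have "N a1 a2 a3 = card (\<Union>t. ?X t \<times> ?Y t)" unfolding N_def by simp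
  also have "\<dots> = (\<Sum>t\<in>UNIV. card (?X t \<times> ?Y t))"
    using a by (intro card_UN_disjoint) auto
  finally have "(of_nat (N a1 a2 a3) :: complex) = (\<Sum>t\<in>UNIV. of_nat (card (?X t)) * of_nat (card (?Y t)))"
    by (simp add: card_cartesian_product)
  also have "\<dots> = (\<Sum>t\<in>UNIV. 1 + \<alpha> * \<chi> t + \<alpha>\<^sup>2 * (\<chi> t)\<^sup>2 + \<beta> * \<chi> (1 - t) + \<beta>\<^sup>2 * (\<chi> (1 - t))\<^sup>2
      + \<alpha> * \<beta> * (\<chi> t * \<chi> (1 - t)) + \<alpha>\<^sup>2 * \<beta>\<^sup>2 * ((\<chi> t)\<^sup>2 * (\<chi> (1 - t))\<^sup>2)
      + \<alpha>\<^sup>2 * \<beta> * ((\<chi> t)\<^sup>2 * \<chi> (1 - t)) + \<alpha> * \<beta>\<^sup>2 * (\<chi> t * (\<chi> (1 - t))\<^sup>2))"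
  proof (intro sum.cong refl)
    fix t :: 'a
    have 1: "of_nat (card (?X t)) = 1 + \<alpha> * \<chi> t + (\<alpha> * \<chi> t)\<^sup>2"
      unfolding card_cube_roots \<alpha>_def by (simp only: chi_mult)
    have 2: "of_nat (card (?Y t)) = 1 + \<beta> * \<chi> (1 - t) + (\<beta> * \<chi> (1 - t))\<^sup>2"
      unfolding card_cube_roots \<beta>_def by (simp only: chi_mult)
    show "of_nat (card (?X t)) * of_nat (card (?Y t)) = 1 + \<alpha> * \<chi> t + \<alpha>\<^sup>2 * (\<chi> t)\<^sup>2 + \<beta> * \<chi> (1 - t) + \<beta>\<^sup>2 * (\<chi> (1 - t))\<^sup>2
      + \<alpha> * \<beta> * (\<chi> t * \<chi> (1 - t)) + \<alpha>\<^sup>2 * \<beta>\<^sup>2 * ((\<chi> t)\<^sup>2 * (\<chi> (1 - t))\<^sup>2)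
      + \<alpha>\<^sup>2 * \<beta> * ((\<chi> t)\<^sup>2 * \<chi> (1 - t)) + \<alpha> * \<beta>\<^sup>2 * (\<chi> t * (\<chi> (1 - t))\<^sup>2)"
      unfolding 1 2 power_mult_distrib by (simp add: algebra_simps)
  qed
  also have "\<dots> = of_nat CARD('a) + \<alpha> * \<beta> * J + \<alpha>\<^sup>2 * \<beta>\<^sup>2 * cnj J - \<alpha>\<^sup>2 * \<beta> - \<alpha> * \<beta>\<^sup>2"
    unfolding sum.distrib sum_distrib_left[symmetric] J_def[symmetric] cnj_J[symmetric]
      sum_chi sum_chi_square sum_chi_square_chi sum_chi_chi_square
      sum_reflect[of \<chi>] sum_reflect[of "\<lambda>t. (\<chi> t)\<^sup>2"]
    by simp
  \<comment> \<open>The product \<open>\<alpha> * \<beta> * A\<close> is the character of the cube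
    \<open>a3 ^ 3\<close>, so \<open>\<alpha> * \<beta>\<close> is the inverse of the cube root of
    unity \<open>A\<close>.\<close>
  also have "\<alpha> * \<beta> = A\<^sup>2"
  proof -
    have "\<alpha> * \<beta> * A = \<chi> (a3 * inverse a1 * (a3 * inverse a2) * (a1 * a2 * a3))"
      unfolding \<alpha>_def \<beta>_def A_def by (simp only: chi_mult)
    also have "a3 * inverse a1 * (a3 * inverse a2) * (a1 * a2 * a3) = a3 * a3 * a3"
      using a by (simp add: field_simps)
    also have "\<chi> (a3 * a3 * a3) = 1" using chi_cube[OF a(3)] by (simp add: chi_mult power3_eq_cube)
    finally have 1: "\<alpha> * \<beta> * A = 1" .
    have 2: "A ^ 3 = 1" unfolding A_def using a by (intro chi_cube) simp
    have "\<alpha> * \<beta> = \<alpha> * \<beta> * A ^ 3" using 2 by simp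
    also have "\<dots> = \<alpha> * \<beta> * A * A\<^sup>2" by (simp add: power3_eq_cube power2_eq_square)
    finally show ?thesis using 1 by simp
  qed
  also have "\<alpha>\<^sup>2 * \<beta>\<^sup>2 = A"
  proof -
    have "A ^ 3 = 1" unfolding A_def using a by (intro chi_cube) simp
    moreover have "\<alpha>\<^sup>2 * \<beta>\<^sup>2 = A ^ 3 * A"
      unfolding power_mult_distrib[symmetric] \<open>\<alpha> * \<beta> = A\<^sup>2\<close> by (simp add: power3_eq_cube power2_eq_square)
    ultimately show ?thesis by simp
  qed
  also have "\<alpha>\<^sup>2 * \<beta> = B"
  proof -
    have "\<beta> = \<alpha> * B"
    proof -
      have "a3 * inverse a2 = a3 * inverse a1 * (a1 * inverse a2)" using a by simp
      then show ?thesis unfolding \<alpha>_def \<beta>_def B_def by (metis chi_mult)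
    qed
    then have "\<alpha>\<^sup>2 * \<beta> = \<alpha> ^ 3 * B" by (simp add: power3_eq_cube power2_eq_square)
    also have "\<alpha> ^ 3 = 1" unfolding \<alpha>_def using a by (intro chi_cube) simp
    finally show ?thesis by simp
  qed
  also have "\<alpha> * \<beta>\<^sup>2 = B\<^sup>2"
  proof -
    have "B\<^sup>2 = \<alpha> ^ 3 * (\<alpha> * \<beta>\<^sup>2)"
      unfolding \<open>\<alpha>\<^sup>2 * \<beta> = B\<close>[symmetric] by (simp add: power3_eq_cube power2_eq_square)
    also have "\<alpha> ^ 3 = 1" unfolding \<alpha>_def using a by (intro chi_cube) simp
    finally show ?thesis by simp
  qed
  finally show ?thesis by (simp add: algebra_simps)
qed

lemma N_cubic:
  assumes a: "a1 \<noteq> 0" "a2 \<noteq> 0" "a3 \<noteq> (0::'a)" and "cubic (a1 * a2 * a3)"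
  shows "int (N a1 a2 a3) = int CARD('a) + rep_c - (if cubic (a1 * inverse a2) then 2 else - 1)"
proof -
  have A: "\<chi> (a1 * a2 * a3) = 1" using assms by (simp add: chi_eq_1_iff)
  have "J + cnj J = of_int rep_c"
    by (simp add: J_eq cnj_omega omega_square rep_c_def algebra_simps)
  then have "(of_int (int (N a1 a2 a3)) :: complex)
      = of_int (int CARD('a) + rep_c - (if cubic (a1 * inverse a2) then 2 else - 1))"
    using N_eq[OF a] chi_sum_square[of "a1 * inverse a2"] a unfolding A by (auto simp: algebra_simps split: if_splits)
  then show ?thesis by (simp only: of_int_eq_iff)
qed

text \<open>Here \<open>\<chi> (a1 * a2 * a3) = \<omega>\<close>, so the trace of
  \<open>\<omega>\<^sup>2 * J\<close> takes the place of that of \<open>J\<close>. Its double is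
  \<open>9 * jacobi_v - rep_c\<close>; doubling keeps the identity in the integers.\<close>

lemma N_noncubic:
  assumes a: "a1 \<noteq> 0" "a2 \<noteq> 0" "a3 \<noteq> (0::'a)" and "(a1 * a2 * a3) ^ m = \<zeta>"
  shows "2 * int (N a1 a2 a3)
    = 2 * int CARD('a) + (9 * jacobi_v - rep_c) - 2 * (if cubic (a1 * inverse a2) then 2 else - 1)"
proof -
  have A: "\<chi> (a1 * a2 * a3) = \<omega>" using assms by (simp add: \<chi>_def)
  define P :: complex where "P = 3 * of_int jacobi_u - of_nat CARD('a)"
  have J: "J = P + 3 * of_int jacobi_v * \<omega>" by (simp add: J_eq P_def algebra_simps)
  have "\<omega>\<^sup>2 * J + \<omega> * cnj J = P * (\<omega> + \<omega>\<^sup>2) + 6 * of_int jacobi_v * \<omega> ^ 3"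
    unfolding J by (simp add: P_def cnj_omega algebra_simps power2_eq_square power3_eq_cube)
  also have "\<dots> = - P + 6 * of_int jacobi_v" by (simp add: omega_square omega_cube)
  finally have S: "2 * (\<omega>\<^sup>2 * J + \<omega> * cnj J) = of_int (9 * jacobi_v - rep_c)"
    by (simp add: P_def rep_c_def)
  have "2 * of_nat (N a1 a2 a3) = 2 * of_nat CARD('a) + 2 * (\<omega>\<^sup>2 * J + \<omega> * cnj J)
      - 2 * (if cubic (a1 * inverse a2) then 2 else - 1 :: complex)"
    using N_eq[OF a] chi_sum_square[of "a1 * inverse a2"] a unfolding A by simp
  then have "(of_int (2 * int (N a1 a2 a3)) :: complex)
      = of_int (2 * int CARD('a) + (9 * jacobi_v - rep_c) - 2 * (if cubic (a1 * inverse a2) then 2 else - 1))"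
    unfolding S by (auto split: if_splits)
  then show ?thesis by (simp only: of_int_eq_iff)
qed

section \<open>Normalisation and the sign of the second coordinate\<close>

text \<open>Coprimality is the only point left: \<open>rep_c\<close> reduces to a central binomial
  coefficient up to sign, and \<open>p\<close> does not divide it.\<close>

lemma normalized_rep_c:
  assumes "prime p" "[p = 1] (mod 3)" "CARD('a) = p ^ k"
  shows "normalized_rep p CARD('a) rep_c jacobi_v"
proof -
  have "\<not> p dvd (2 * m) choose m"
    using assms card_eq by (intro prime_not_dvd_central_binomial) auto
  then have "of_nat ((2 * m) choose m) \<noteq> (0::'a)"
    using finite_field_CHAR_eq[OF assms(1,3)] by (simp add: of_nat_eq_0_iff_char_dvd)
  then have "of_int rep_c \<noteq> (0::'a)" by (simp add: rep_c_mod(1))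
  then have "\<not> int p dvd rep_c"
    using finite_field_CHAR_eq[OF assms(1,3)] by (simp add: of_int_eq_0_iff_char_dvd)
  then have "coprime rep_c (int p)"
    using assms(1) by (simp add: coprime_commute prime_imp_coprime)
  then show ?thesis
    unfolding normalized_rep_def using four_card_eq rep_c_cong_1 by simp
qed

lemma sign_condition_jacobi_v:
  assumes "prime p" "[p = 1] (mod 3)" "CARD('a) = p ^ k" and a: "a ^ m = \<zeta>"
  shows "sign_condition p a rep_c jacobi_v"
proof -
  have ch: "CHAR('a) = p" using finite_field_CHAR_eq[OF assms(1,3)] .
  have cop: "coprime rep_c (int p)"
    using normalized_rep_c[OF assms(1-3)] by (simp add: normalized_rep_def)
  have "p \<noteq> 2" using assms(2) by (auto simp: cong_def)
  then have cop2: "coprime 2 (int p)" using assms(1) prime_odd_nat[of p] prime_ge_2_nat[of p] by simp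
  obtain x y where xy: "[rep_c * x = 1] (mod int p)" "[2 * y = 1] (mod int p)"
    using cong_solve_coprime_int[OF cop] cong_solve_coprime_int[OF cop2] by blast
  have x: "of_int rep_c * of_int x = (1::'a)"
    using xy(1) of_int_eq_iff_cong_CHAR[where ?'a = 'a, of "rep_c * x" 1] ch by simp
  have y: "2 * of_int y = (1::'a)"
    using xy(2) of_int_eq_iff_cong_CHAR[where ?'a = 'a, of "2 * y" 1] ch by simp
  \<comment> \<open>Solving \<open>9 * jacobi_v = rep_c * (2 * w + 1)\<close> modulo
    \<open>p\<close> for \<open>w\<close>, with \<open>x\<close> and \<open>y\<close> as inverses of
    \<open>rep_c\<close> and 2. By \<open>rep_c_mod\<close> this integer represents
    \<open>\<zeta>\<close>, which thus lies in the prime field.\<close>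
  define w where "w = (9 * jacobi_v * x - 1) * y"
  have "(of_int w :: 'a) = (of_int (9 * jacobi_v) * of_int x - 1) * of_int y"
    by (simp add: w_def)
  also have "\<dots> = ((2 * \<zeta> + 1) * (of_int rep_c * of_int x) - 1) * of_int y"
    unfolding rep_c_mod(2) by (simp add: mult_ac)
  also have "\<dots> = \<zeta> * (2 * of_int y)" unfolding x by (simp add: mult_ac)
  finally have w: "of_int w = \<zeta>" using y by simp
  then have "of_int (9 * jacobi_v) = (of_int (rep_c * (2 * w + 1)) :: 'a)"
    unfolding rep_c_mod(2) by simp
  then have "[9 * jacobi_v = rep_c * (2 * w + 1)] (mod int p)"
    by (simp only: of_int_eq_iff_cong_CHAR ch)
  moreover have "(CARD('a) - 1) div 3 = m" using card_eq by simp
  ultimately show ?thesis unfolding sign_condition_def using w a by auto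
qed

end

text \<open>Two integers representing the same field element agree modulo \<open>p\<close>, so both
  signs together would give that \<open>p\<close> divides \<open>18 * d\<close>, hence
  \<open>d\<close>, hence \<open>c\<close>.\<close>

lemma sign_condition_uminus:
  fixes a :: "'a::{field,finite}"
  assumes "prime p" "p > 3" "k > 0" "CARD('a) = p ^ k" "normalized_rep p (p ^ k) c d"
    and "sign_condition p a c d"
  shows "\<not> sign_condition p a c (- d)"
proof
  assume "sign_condition p a c (- d)"
  then obtain w' where w': "of_int w' = a ^ ((CARD('a) - 1) div 3)" "[9 * (- d) = c * (2 * w' + 1)] (mod int p)"
    unfolding sign_condition_def by blast
  obtain w where w: "of_int w = a ^ ((CARD('a) - 1) div 3)" "[9 * d = c * (2 * w + 1)] (mod int p)"
    using assms(6) unfolding sign_condition_def by blast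
  have "[w = w'] (mod int p)"
    using w(1) w'(1) of_int_eq_iff_cong_CHAR[where ?'a = 'a, of w w'] finite_field_CHAR_eq[OF assms(1,4)] by simp
  then have "[c * (2 * w + 1) = c * (2 * w' + 1)] (mod int p)"
    by (intro cong_mult cong_add cong_refl)
  with w(2) w'(2) have "[9 * d = 9 * (- d)] (mod int p)" by (meson cong_sym cong_trans)
  then have "int p dvd 9 * d - 9 * (- d)" by (simp only: cong_iff_dvd_diff)
  also have "9 * d - 9 * (- d) = 2 * (3 * (3 * d))" by simp
  finally have "int p dvd 2 * (3 * (3 * d))" .
  moreover have "\<not> int p dvd 2" "\<not> int p dvd 3" using assms(2) by (auto dest: zdvd_imp_le)
  ultimately have "int p dvd d" using assms(1)
    by (metis prime_dvd_mult_iff prime_nat_int_transfer)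
  moreover have "int p dvd int (p ^ k)" using assms(3) by (simp add: dvd_power)
  ultimately have "int p dvd 4 * int (p ^ k) - 27 * d\<^sup>2"
    by (intro dvd_diff dvd_mult) (auto simp: power2_eq_square)
  also have "4 * int (p ^ k) - 27 * d\<^sup>2 = c\<^sup>2"
    using assms(5) unfolding normalized_rep_def by linarith
  finally have "int p dvd c" using assms(1) by (meson prime_dvd_power prime_nat_int_transfer)
  moreover have "coprime c (int p)" using assms(5) by (simp add: normalized_rep_def)
  ultimately show False
    using assms(1) by (metis coprime_common_divisor dvd_refl not_prime_unit prime_nat_int_transfer)
qed

theorem theorem1p10:
  fixes p k q :: nat and a1 a2 a3 :: "'a::{field,finite}"
  assumes "prime p" and "[p = 1] (mod 3)"
    and "q = p ^ k" and "CARD('a) = q"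
    and "a1 \<noteq> 0" and "a2 \<noteq> 0" and "a3 \<noteq> 0"
  shows
    "(cubic (a1 * a2 * a3) \<longrightarrow>
        (\<exists>!c. \<exists>d. normalized_rep p q c d) \<and>
        (\<forall>c d. normalized_rep p q c d \<longrightarrow>
           (if cubic (a1 * inverse a2)
            then int (N a1 a2 a3) = int q - 2 + c
            else int (N a1 a2 a3) = int q + 1 + c))) \<and>
     (\<not> cubic (a1 * a2 * a3) \<longrightarrow>
        (\<exists>!(c, d). normalized_rep p q c d \<and> sign_condition p (a1 * a2 * a3) c d) \<and>
        (\<forall>c d. normalized_rep p q c d \<and> sign_condition p (a1 * a2 * a3) c d \<longrightarrow>
           (if cubic (a1 * inverse a2)
            then real (N a1 a2 a3) = real q - 2 + 1 / 2 * real_of_int (9 * d - c)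
            else real (N a1 a2 a3) = real q + 1 + 1 / 2 * real_of_int (9 * d - c))))"
proof -
  have p3: "p > 3"
  proof (rule ccontr)
    assume "\<not> p > 3"
    then have "p = 0 \<or> p = 1 \<or> p = 2 \<or> p = 3" by auto
    with assms(1,2) show False by (auto simp: cong_def)
  qed
  \<comment> \<open>A field has at least two elements, which excludes \<open>k = 0\<close>.\<close>
  have "card {0::'a, 1} \<le> CARD('a)" by (intro card_mono) auto
  then have q2: "q \<ge> 2" using assms(4) by simp
  then have k0: "k > 0" using assms(3) by (cases k) auto
  define m where "m = (q - 1) div 3"
  have "[q = 1] (mod 3)" using cong_pow[OF assms(2), of k] assms(3) by simp
  then have "q mod 3 = 1" by (simp add: cong_def)
  then have m: "q = 3 * m + 1" using mult_div_mod_eq[of 3 q] unfolding m_def by presburger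
  then have m0: "m > 0" using q2 by auto
  have cardp: "CARD('a) = p ^ k" and card3: "CARD('a) = 3 * m + 1" using assms m by simp_all
  note uniq = normalized_rep_unique[OF assms(1) p3 assms(3) k0]
  have root: "cube_root_field (g ^ m) m" if "g \<noteq> 0" "g ^ m \<noteq> 1" for g :: 'a
  proof
    have "(g ^ m) ^ 3 = g ^ (CARD('a) - 1)" by (simp add: card3 mult.commute flip: power_mult)
    then show "(g ^ m) ^ 3 = 1" using finite_field_power_card_minus_1[OF that(1)] by simp
  qed (use that card3 in auto)
  obtain g :: 'a where g: "g \<noteq> 0" "g ^ m \<noteq> 1"
    using finite_field_exists_power_neq_1[OF m0, where ?'a = 'a] card3 m0 by auto
  \<comment> \<open>In the cubic case any nontrivial cube root of unity serves, because
    \<open>N_cubic\<close> involves only \<open>rep_c\<close>.\<close>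
  interpret G: cube_root_field "g ^ m" m using root[OF g] .
  show ?thesis
  proof (intro conjI impI)
    assume cub: "cubic (a1 * a2 * a3)"
    have rep: "normalized_rep p q G.rep_c G.jacobi_v"
      using G.normalized_rep_c[OF assms(1,2) cardp] assms(4) by simp
    show "\<exists>!c. \<exists>d. normalized_rep p q c d"
      using rep uniq by blast
    show "\<forall>c d. normalized_rep p q c d \<longrightarrow>
           (if cubic (a1 * inverse a2)
            then int (N a1 a2 a3) = int q - 2 + c
            else int (N a1 a2 a3) = int q + 1 + c)"
    proof (intro allI impI)
      fix c d assume "normalized_rep p q c d"
      then have "c = G.rep_c" using uniq[OF rep] by blast
      then show "if cubic (a1 * inverse a2) then int (N a1 a2 a3) = int q - 2 + c
            else int (N a1 a2 a3) = int q + 1 + c"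
        using G.N_cubic[OF assms(5-7) cub] assms(4) by simp
    qed
  next
    assume nc: "\<not> cubic (a1 * a2 * a3)"
    \<comment> \<open>In the non-cubic case this power is itself a nontrivial cube root of unity.
      Taking it as \<open>\<zeta>\<close> makes the character of \<open>a1 * a2 * a3\<close> equal
      to \<open>\<omega>\<close>.\<close>
    define \<zeta> where "\<zeta> = (a1 * a2 * a3) ^ m"
    have "\<zeta> \<noteq> 1" using nc G.cubic_iff_power_m by (simp add: \<zeta>_def)
    then interpret Z: cube_root_field \<zeta> m
      using root[of "a1 * a2 * a3"] assms(5-7) by (simp add: \<zeta>_def)
    have rep: "normalized_rep p q Z.rep_c Z.jacobi_v"
      using Z.normalized_rep_c[OF assms(1,2) cardp] assms(4) by simp
    have sgn: "sign_condition p (a1 * a2 * a3) Z.rep_c Z.jacobi_v"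
      using Z.sign_condition_jacobi_v[OF assms(1,2) cardp] by (simp add: \<zeta>_def)
    \<comment> \<open>Uniqueness of the representation leaves only the sign of \<open>d\<close>
      open, and the sign condition decides it.\<close>
    have u: "c = Z.rep_c \<and> d = Z.jacobi_v"
      if "normalized_rep p q c d" "sign_condition p (a1 * a2 * a3) c d" for c d
    proof -
      have "c = Z.rep_c" "d = Z.jacobi_v \<or> d = - Z.jacobi_v"
        using uniq[OF rep that(1)] by blast+
      moreover have "\<not> sign_condition p (a1 * a2 * a3) Z.rep_c (- Z.jacobi_v)"
        using sign_condition_uminus[OF assms(1) p3 k0 cardp _ sgn] rep assms(3) by simp
      ultimately show ?thesis using that(2) by auto
    qed
    show "\<exists>!(c, d). normalized_rep p q c d \<and> sign_condition p (a1 * a2 * a3) c d"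
    proof (rule ex1I[of _ "(Z.rep_c, Z.jacobi_v)"])
      fix z assume "case z of (c, d) \<Rightarrow> normalized_rep p q c d \<and> sign_condition p (a1 * a2 * a3) c d"
      then show "z = (Z.rep_c, Z.jacobi_v)"
        using u[of "fst z" "snd z"] by (simp add: case_prod_beta prod_eq_iff)
    qed (use rep sgn in simp)
    have *: "2 * int (N a1 a2 a3) = 2 * int q + (9 * Z.jacobi_v - Z.rep_c)
        - 2 * (if cubic (a1 * inverse a2) then 2 else - 1)"
      using Z.N_noncubic[OF assms(5-7)] assms(4) by (simp add: \<zeta>_def)
    have "real_of_int (2 * int (N a1 a2 a3)) = real_of_int (2 * int q + (9 * Z.jacobi_v - Z.rep_c)
        - 2 * (if cubic (a1 * inverse a2) then 2 else - 1))"
      unfolding * ..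
    then have N2: "2 * real (N a1 a2 a3) = 2 * real q + real_of_int (9 * Z.jacobi_v - Z.rep_c)
        - 2 * (if cubic (a1 * inverse a2) then 2 else - 1)"
      by (auto split: if_splits)
    show "\<forall>c d. normalized_rep p q c d \<and> sign_condition p (a1 * a2 * a3) c d \<longrightarrow>
           (if cubic (a1 * inverse a2)
            then real (N a1 a2 a3) = real q - 2 + 1 / 2 * real_of_int (9 * d - c)
            else real (N a1 a2 a3) = real q + 1 + 1 / 2 * real_of_int (9 * d - c))"
    proof (intro allI impI)
      fix c d assume "normalized_rep p q c d \<and> sign_condition p (a1 * a2 * a3) c d"
      then have "c = Z.rep_c" "d = Z.jacobi_v" using u by blast+
      then show "if cubic (a1 * inverse a2)
            then real (N a1 a2 a3) = real q - 2 + 1 / 2 * real_of_int (9 * d - c)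
            else real (N a1 a2 a3) = real q + 1 + 1 / 2 * real_of_int (9 * d - c)"
        using N2 by (auto simp: field_simps split: if_splits)
    qed
  qed
qed

end
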